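(* Let $X$ and $Y$ be Möbius categories, and let $F: X \rightleftarrows Y : G$ be an adjunction, $F \dashv G$. Then for all objects $x \in X$, $y \in Y$, $$\sum_{\substack{x' \in X \\ f: x \to x' \\ F x' = y}} \mu_X(f) \;=\; \sum_{\substack{y' \in Y\\ g:y' \to y \\ G y' = x}} \mu_Y(g).$$ Here the left-hand sum is over all pairs $(x',f)$ with $x'$ an object of $X$ such that $Fx'=y$ and $f:x\to x'$ an arrow of $X$, and the right-hand sum is over all pairs $(y',g)$ with $y'$ an object of $Y$ such that $Gy'=x$ and $g:y'\to y$ an arrow of $Y$.
   Context: For a small category $X$, a category is locally finite if each morphism $f:x\to z$ admits only finitely many two-step factorisations $x\xrightarrow{g} y\xrightarrow{h} z$. For an arrow $f$, $\Phi_{\mathrm{even}}(f)$ denotes the number of even-length factorisations of $f$ into composable strings of non-identity arrows, and $\Phi_{\mathrm{odd}}(f)$ the number of odd-length such factorisations (an identity arrow has exactly the factorisation of length $0$). A category $X$ is Möbius if it is locally finite and $\Phi_{\mathrm{even}}(f)$ and $\Phi_{\mathrm{odd}}(f)$ are finite for all arrows $f$. The incidence algebra of $X$ consists of the $\mathbb{Q}$-valued functions on arrows of $X$ with convolution $(\alpha*\beta)(f)=\sum_{hg=f}\alpha(g)\beta(h)$ and unit $\delta$ given by $\delta(\mathrm{id}_x)=1$ and $\delta(f)=0$ for $f$ not an identity. The zeta function is $\zeta_X(f)=1$ for all $f$. For $X$ Möbius, $\zeta_X$ is convolution invertible and its inverse is the Möbius function $\mu_X=\Phi_{\mathrm{e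ven}}-\Phi_{\mathrm{odd}}$.
   Formalization: The sums may have infinitely many nonzero terms (e.g. identity adjunction on two objects with infinitely many parallel arrows), where they are undefined; the equality is asserted as a genuine identity of sums when both have only finitely many nonzero terms. *)

theory Defs
  imports Complex_Main
begin

text \<open>Small categories. \<^term>\<open>Comp C h g\<close> is the composite of \<open>g\<close> followed by \<open>h\<close>.\<close>

record ('o, 'm) category =
  Obj :: "'o set"
  Arr :: "'m set"
  Dom :: "'m \<Rightarrow> 'o"
  Cod :: "'m \<Rightarrow> 'o"
  Ident :: "'o \<Rightarrow> 'm"
  Comp :: "'m \<Rightarrow> 'm \<Rightarrow> 'm"

definition Hom :: "('o, 'm) category \<Rightarrow> 'o \<Rightarrow> 'o \<Rightarrow> 'm set" where
  "Hom C a b = {f \<in> Arr C. Dom C f = a \<and> Cod C f = b}"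

locale category =
  fixes C :: "('o, 'm) category"
  assumes Dom_in_Obj: "f \<in> Arr C \<Longrightarrow> Dom C f \<in> Obj C"
    and Cod_in_Obj: "f \<in> Arr C \<Longrightarrow> Cod C f \<in> Obj C"
    and Ident_in_Hom: "a \<in> Obj C \<Longrightarrow> Ident C a \<in> Hom C a a"
    and Comp_in_Hom: "g \<in> Hom C a b \<Longrightarrow> h \<in> Hom C b c \<Longrightarrow> Comp C h g \<in> Hom C a c"
    and Comp_Ident_right: "f \<in> Hom C a b \<Longrightarrow> Comp C f (Ident C a) = f"
    and Comp_Ident_left: "f \<in> Hom C a b \<Longrightarrow> Comp C (Ident C b) f = f"
    and Comp_assoc: "f \<in> Hom C a b \<Longrightarrow> g \<in> Hom C b c \<Longrightarrow> h \<in> Hom C c d \<Longrightarrow>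
      Comp C h (Comp C g f) = Comp C (Comp C h g) f"

fun composable :: "('o, 'm) category \<Rightarrow> 'o \<Rightarrow> 'm list \<Rightarrow> bool" where
  "composable C a [] \<longleftrightarrow> a \<in> Obj C"
| "composable C a (g # gs) \<longleftrightarrow> g \<in> Arr C \<and> Dom C g = a \<and> composable C (Cod C g) gs"

fun composite :: "('o, 'm) category \<Rightarrow> 'o \<Rightarrow> 'm list \<Rightarrow> 'm" where
  "composite C a [] = Ident C a"
| "composite C a (g # gs) = Comp C (composite C (Cod C g) gs) g"

text \<open>The empty string, based at the domain of \<open>f\<close>, factorises \<open>f\<close> exactly when \<open>f\<close>
  is an identity arrow.\<close>

definition factorisations :: "('o, 'm) category \<Rightarrow> 'm \<Rightarrow> 'm list set" where
  "factorisations C f = {gs. composable C (Dom C f) gs \<and> composite C (Dom C f) gs = f \<and>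
     (\<forall>g \<in> set gs. g \<notin> Ident C ` Obj C)}"

definition even_factorisations :: "('o, 'm) category \<Rightarrow> 'm \<Rightarrow> 'm list set" where
  "even_factorisations C f = {gs \<in> factorisations C f. even (length gs)}"

definition odd_factorisations :: "('o, 'm) category \<Rightarrow> 'm \<Rightarrow> 'm list set" where
  "odd_factorisations C f = {gs \<in> factorisations C f. odd (length gs)}"

definition Phi_even :: "('o, 'm) category \<Rightarrow> 'm \<Rightarrow> nat" where
  "Phi_even C f = card (even_factorisations C f)"

definition Phi_odd :: "('o, 'm) category \<Rightarrow> 'm \<Rightarrow> nat" where
  "Phi_odd C f = card (odd_factorisations C f)"

definition locally_finite :: "('o, 'm) category \<Rightarrow> bool" where
  "locally_finite C \<longleftrightarrow> (\<forall>f \<in> Arr C.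
     finite {(g, h). g \<in> Arr C \<and> h \<in> Arr C \<and> Cod C g = Dom C h \<and> Comp C h g = f})"

locale moebius_category = category C for C :: "('o, 'm) category" +
  assumes locally_finite: "locally_finite C"
    and finite_even: "f \<in> Arr C \<Longrightarrow> finite (even_factorisations C f)"
    and finite_odd: "f \<in> Arr C \<Longrightarrow> finite (odd_factorisations C f)"

definition moebius :: "('o, 'm) category \<Rightarrow> 'm \<Rightarrow> rat" where
  "moebius C f = of_nat (Phi_even C f) - of_nat (Phi_odd C f)"

locale cat_functor = X: category X + Y: category Y
  for X :: "('o1, 'm1) category" and Y :: "('o2, 'm2) category" +
  fixes Fo :: "'o1 \<Rightarrow> 'o2" and Fm :: "'m1 \<Rightarrow> 'm2"
  assumes map_Obj: "a \<in> Obj X \<Longrightarrow> Fo a \<in> Obj Y"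
    and map_Hom: "f \<in> Hom X a b \<Longrightarrow> Fm f \<in> Hom Y (Fo a) (Fo b)"
    and map_Ident: "a \<in> Obj X \<Longrightarrow> Fm (Ident X a) = Ident Y (Fo a)"
    and map_Comp: "f \<in> Hom X a b \<Longrightarrow> g \<in> Hom X b c \<Longrightarrow>
      Fm (Comp X g f) = Comp Y (Fm g) (Fm f)"

text \<open>An adjunction with left adjoint \<open>F\<close> and right adjoint \<open>G\<close>: bijections
  \<open>\<phi> x y : Hom (F x) y \<rightarrow> Hom x (G y)\<close>, natural in both variables.\<close>

locale adjunction = F: cat_functor X Y Fo Fm + G: cat_functor Y X Go Gm
  for X :: "('o1, 'm1) category" and Y :: "('o2, 'm2) category"
    and Fo :: "'o1 \<Rightarrow> 'o2" and Fm :: "'m1 \<Rightarrow> 'm2"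
    and Go :: "'o2 \<Rightarrow> 'o1" and Gm :: "'m2 \<Rightarrow> 'm1" +
  fixes \<phi> :: "'o1 \<Rightarrow> 'o2 \<Rightarrow> 'm2 \<Rightarrow> 'm1"
  assumes hom_bij: "x \<in> Obj X \<Longrightarrow> y \<in> Obj Y \<Longrightarrow>
      bij_betw (\<phi> x y) (Hom Y (Fo x) y) (Hom X x (Go y))"
    and hom_natural: "u \<in> Hom X x' x \<Longrightarrow> k \<in> Hom Y (Fo x) y \<Longrightarrow> v \<in> Hom Y y y' \<Longrightarrow>
      \<phi> x' y' (Comp Y v (Comp Y k (Fm u))) = Comp X (Gm v) (Comp X (\<phi> x y k) u)"

definition left_index ::
  "('o1, 'm1) category \<Rightarrow> ('o1 \<Rightarrow> 'o2) \<Rightarrow> 'o1 \<Rightarrow> 'o2 \<Rightarrow> ('o1 \<times> 'm1) set" where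
  "left_index X Fo x y = {(x', f). x' \<in> Obj X \<and> f \<in> Hom X x x' \<and> Fo x' = y}"

definition right_index ::
  "('o2, 'm2) category \<Rightarrow> ('o2 \<Rightarrow> 'o1) \<Rightarrow> 'o1 \<Rightarrow> 'o2 \<Rightarrow> ('o2 \<times> 'm2) set" where
  "right_index Y Go x y = {(y', g). y' \<in> Obj Y \<and> g \<in> Hom Y y' y \<and> Go y' = x}"

text \<open>Hom-sets of a Moebius category may be infinite, so these index sets may be infinite.
  A sum over an index set \<open>I\<close> then still makes sense if only finitely many terms are
  nonzero; it is the sum over the support below.\<close>

definition moebius_support ::
  "('o, 'm) category \<Rightarrow> ('o \<times> 'm) set \<Rightarrow> ('o \<times> 'm) set" where
  "moebius_support C I = {(a, f) \<in> I. moebius C f \<noteq> 0}"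

end

theory Submission
  imports Defs
begin

text \<open>Think of the arrows \<open>F x \<rightarrow> y\<close>, equivalently \<open>x \<rightarrow> G y\<close>, as heteromorphisms from \<open>x\<close> to \<open>y\<close>. They
can be composed with arrows of \<open>X\<close> on one side and with arrows of \<open>Y\<close> on the other, so functions
on them can be convolved with elements of the two incidence algebras. Let \<open>\<zeta>\<close> be the function
with constant value \<open>1\<close> on heteromorphisms and evaluate the associative product
\<open>\<mu>\<^sub>X * \<zeta> * \<mu>\<^sub>Y\<close> at a heteromorphism \<open>m : F x \<rightarrow> y\<close>. Moebius inversion in \<open>Y\<close> shows that \<open>\<zeta> * \<mu>\<^sub>Y\<close>
is the indicator function of those heteromorphisms \<open>F x' \<rightarrow> y\<close> that are identities of \<open>Y\<close>, so the
value is the sum of \<open>\<mu>\<^sub>X(f)\<close> over the \<open>f : x \<rightarrow> x'\<close> with \<open>F x' = y\<close> and \<open>F f = m\<close>. Moebius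
inversion in \<open>X\<close> shows that \<open>\<mu>\<^sub>X * \<zeta>\<close> is the indicator function of the heteromorphisms whose
transposes \<open>x \<rightarrow> G y'\<close> are identities of \<open>X\<close>, so the value is also the sum of \<open>\<mu>\<^sub>Y(g)\<close> over the
\<open>g : y' \<rightarrow> y\<close> with \<open>G y' = x\<close> and \<open>G g\<close> equal to the transpose of \<open>m\<close>. This is
\<open>fibre_sums_eq\<close>; every sum in it is finite because \<open>X\<close> and \<open>Y\<close> are locally finite.

The two sums of the theorem are fibred over \<open>m\<close> in this way. If the supports of the Moebius
functions on the index sets are finite, only finitely many \<open>m\<close> matter and adding up the fibre
sums gives the claim (\<open>support_sums_eq\<close>).

For the unrestricted sums, with value \<open>0\<close> on infinite index sets, it remains to see that a finite
nonempty index set is never paired with an infinite one. In a Moebius category an identity has no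
nontrivial factorisation (\<open>identity_indecomposable\<close>), so the triangle identities force
\<open>G (F (G y')) = G y'\<close> and \<open>F (G (F x')) = F x'\<close>. When both index sets are nonempty, this
embeds the hom-set from \<open>F x\<close> to \<open>y\<close> into each of them; as each is fibred over that hom-set with
finite fibres, they are finite or infinite together (\<open>finite_left_index_iff\<close>,
\<open>finite_right_index_iff\<close>, \<open>index_sums_eq\<close>).\<close>

section \<open>Moebius inversion\<close>

definition factor_pairs :: "('o, 'm) category \<Rightarrow> 'm \<Rightarrow> ('m \<times> 'm) set" where
  "factor_pairs C f =
     {(g, h). g \<in> Arr C \<and> h \<in> Arr C \<and> Cod C g = Dom C h \<and> Comp C h g = f}"

definition delta :: "('o, 'm) category \<Rightarrow> 'm \<Rightarrow> rat" where
  "delta C f = of_bool (f \<in> Ident C ` Obj C)"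

context category
begin

lemma HomD:
  assumes "f \<in> Hom C a b"
  shows "f \<in> Arr C" "Dom C f = a" "Cod C f = b" "a \<in> Obj C" "b \<in> Obj C"
  using assms Dom_in_Obj Cod_in_Obj by (auto simp: Hom_def)

lemma Ident_props:
  assumes "a \<in> Obj C"
  shows "Ident C a \<in> Arr C" "Dom C (Ident C a) = a" "Cod C (Ident C a) = a"
  using HomD[OF Ident_in_Hom[OF assms]] by auto

lemma Comp_props:
  assumes "g \<in> Arr C" "h \<in> Arr C" "Cod C g = Dom C h"
  shows "Comp C h g \<in> Arr C" "Dom C (Comp C h g) = Dom C g" "Cod C (Comp C h g) = Cod C h"
proof -
  have "Comp C h g \<in> Hom C (Dom C g) (Cod C h)"
    using assms by (intro Comp_in_Hom[of _ _ "Dom C h"]) (auto simp: Hom_def)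
  then show "Comp C h g \<in> Arr C" "Dom C (Comp C h g) = Dom C g" "Cod C (Comp C h g) = Cod C h"
    by (auto simp: Hom_def)
qed

lemma Comp_Ident:
  assumes "f \<in> Arr C"
  shows "Comp C f (Ident C (Dom C f)) = f" "Comp C (Ident C (Cod C f)) f = f"
  using assms Comp_Ident_right[of f] Comp_Ident_left[of f] by (auto simp: Hom_def)

lemma composite_props:
  assumes "composable C a gs"
  shows "composite C a gs \<in> Arr C" "Dom C (composite C a gs) = a"
  using assms by (induction gs arbitrary: a) (auto simp: Ident_props Comp_props)

lemma composable_snoc:
  "composable C a (gs @ [h]) \<longleftrightarrow>
     composable C a gs \<and> h \<in> Arr C \<and> Dom C h = Cod C (composite C a gs)"
proof (induction gs arbitrary: a)
  case Nil
  then show ?case using Ident_props Dom_in_Obj Cod_in_Obj by auto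
next
  case (Cons g gs)
  show ?case
  proof (cases "g \<in> Arr C \<and> composable C (Cod C g) gs")
    case True
    then have "Cod C (composite C a (g # gs)) = Cod C (composite C (Cod C g) gs)"
      by (simp add: Comp_props(3) composite_props)
    with Cons.IH show ?thesis by auto
  next
    case False
    with Cons.IH show ?thesis by auto
  qed
qed

lemma composite_snoc:
  assumes "composable C a (gs @ [h])"
  shows "composite C a (gs @ [h]) = Comp C h (composite C a gs)"
  using assms
proof (induction gs arbitrary: a)
  case Nil
  then show ?case by (auto simp: Comp_Ident Cod_in_Obj)
next
  case (Cons g gs)
  let ?k = "composite C (Cod C g) gs"
  have *: "composable C (Cod C g) (gs @ [h])" "g \<in> Arr C"
    using Cons.prems by auto
  then have "?k \<in> Arr C" "Dom C ?k = Cod C g" "h \<in> Arr C" "Dom C h = Cod C ?k"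
    by (auto simp: composable_snoc composite_props)
  then have "Comp C h (Comp C ?k g) = Comp C (Comp C h ?k) g"
    using * by (intro Comp_assoc[of g "Dom C g" "Cod C g" ?k "Cod C ?k" h "Cod C h"])
      (auto simp: Hom_def)
  with Cons.IH[OF *(1)] show ?case by simp
qed

lemma Nil_in_factorisations:
  assumes "f \<in> Arr C"
  shows "[] \<in> factorisations C f \<longleftrightarrow> f \<in> Ident C ` Obj C"
  using assms Dom_in_Obj[OF assms]
  by (auto simp: factorisations_def Ident_props intro: rev_image_eqI)

end

context moebius_category
begin

lemma finite_factorisations:
  assumes "f \<in> Arr C"
  shows "finite (factorisations C f)"
proof -
  have "factorisations C f = even_factorisations C f \<union> odd_factorisations C f"
    by (auto simp: even_factorisations_def odd_factorisations_def)
  with finite_even[OF assms] finite_odd[OF assms] show ?thesis by simp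
qed

lemma finite_factor_pairs: "f \<in> Arr C \<Longrightarrow> finite (factor_pairs C f)"
  using locally_finite by (simp add: locally_finite_def factor_pairs_def)

lemma moebius_signed_sum:
  assumes "f \<in> Arr C"
  shows "moebius C f = (\<Sum>gs \<in> factorisations C f. (- 1) ^ length gs)"
proof -
  let ?s = "\<lambda>gs. (- 1) ^ length gs :: rat"
  have "sum ?s (factorisations C f) =
      sum ?s (even_factorisations C f) + sum ?s (odd_factorisations C f)"
    using finite_even[OF assms] finite_odd[OF assms]
    by (subst sum.union_disjoint[symmetric])
      (auto simp: even_factorisations_def odd_factorisations_def intro!: sum.cong)
  also have "sum ?s (even_factorisations C f) = (\<Sum>gs \<in> even_factorisations C f. 1)"
    by (intro sum.cong) (auto simp: even_factorisations_def)
  also have "sum ?s (odd_factorisations C f) = (\<Sum>gs \<in> odd_factorisations C f. - 1)"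
    by (intro sum.cong) (auto simp: odd_factorisations_def)
  finally show ?thesis
    by (simp add: moebius_def Phi_even_def Phi_odd_def)
qed

text \<open>Every nonempty factorisation has a first and a last arrow; isolating the empty one, which
contributes \<open>\<delta>(f)\<close>, leaves a sum that can be reorganised by either of them.\<close>

lemma moebius_split_Nil:
  assumes "f \<in> Arr C"
  shows "moebius C f = delta C f + (\<Sum>gs \<in> factorisations C f - {[]}. (- 1) ^ length gs)"
proof (cases "[] \<in> factorisations C f")
  case True
  then have "delta C f = 1"
    using Nil_in_factorisations[OF assms] by (simp add: delta_def)
  with True show ?thesis
    by (simp add: moebius_signed_sum[OF assms] sum.remove[OF finite_factorisations[OF assms] True])
next
  case False
  then have "delta C f = 0"
    using Nil_in_factorisations[OF assms] by (simp add: delta_def)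
  with False show ?thesis
    by (simp add: moebius_signed_sum[OF assms])
qed

text \<open>Moebius inversion \<open>\<zeta> * \<mu> = \<delta>\<close>. Cutting off the first arrow \<open>g\<close> of a nonempty factorisation of \<open>f\<close>
leaves a factorisation, of opposite parity, of the remaining factor \<open>h\<close>; hence \<open>\<mu>(f)\<close> equals
\<open>\<delta>(f)\<close> minus the sum of \<open>\<mu>(h)\<close> over all \<open>hg = f\<close> with \<open>g\<close> not an identity. The missing
term, with \<open>g\<close> an identity, is \<open>\<mu>(f)\<close> itself.\<close>

lemma zeta_moebius:
  assumes f: "f \<in> Arr C"
  shows "(\<Sum>(g, h) \<in> factor_pairs C f. moebius C h) = delta C f"
proof -
  let ?I = "Ident C ` Obj C"
  let ?N = "{(g, h) \<in> factor_pairs C f. g \<notin> ?I}"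
  have fin: "finite (factor_pairs C f)" using finite_factor_pairs[OF f] .
  have "(\<Sum>gs \<in> factorisations C f - {[]}. (- 1) ^ length gs :: rat) =
      (\<Sum>((g, h), hs) \<in> Sigma ?N (\<lambda>(g, h). factorisations C h). - ((- 1) ^ length hs))"
    by (rule sum.reindex_bij_witness
          [where i = "\<lambda>((g, h), hs). g # hs"
             and j = "\<lambda>gs. ((hd gs, composite C (Cod C (hd gs)) (tl gs)), tl gs)"])
       (auto simp: factorisations_def factor_pairs_def composite_props Comp_props
          neq_Nil_conv)
  also have "\<dots> = (\<Sum>(g, h) \<in> ?N. - moebius C h)"
  proof -
    have "finite ?N" using fin by (rule finite_subset[rotated]) auto
    moreover have "finite (factorisations C h)" if "(g, h) \<in> ?N" for g h
      using that finite_factorisations by (auto simp: factor_pairs_def)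
    ultimately show ?thesis
      by (subst sum.Sigma[symmetric])
         (auto simp: case_prod_unfold factor_pairs_def moebius_signed_sum sum_negf
           intro!: sum.cong)
  qed
  finally have "moebius C f = delta C f - (\<Sum>(g, h) \<in> ?N. moebius C h)"
    using moebius_split_Nil[OF f] by (simp add: case_prod_unfold sum_negf)
  moreover have eq: "factor_pairs C f = insert (Ident C (Dom C f), f) ?N"
    using f by (auto simp: factor_pairs_def Ident_props Dom_in_Obj Comp_Ident)
  then have "(\<Sum>(g, h) \<in> factor_pairs C f. moebius C h) =
      moebius C f + (\<Sum>(g, h) \<in> ?N. moebius C h)"
  proof -
    have "finite ?N" "(Ident C (Dom C f), f) \<notin> ?N"
      using fin f by (auto simp: Dom_in_Obj intro: finite_subset[rotated])
    then show ?thesis by (subst eq, subst sum.insert) simp_all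
  qed
  ultimately show ?thesis by simp
qed

text \<open>The other inversion \<open>\<mu> * \<zeta> = \<delta>\<close>, by cutting off the last arrow instead of the first.\<close>

lemma moebius_zeta:
  assumes f: "f \<in> Arr C"
  shows "(\<Sum>(g, h) \<in> factor_pairs C f. moebius C g) = delta C f"
proof -
  let ?I = "Ident C ` Obj C"
  let ?N = "{(g, h) \<in> factor_pairs C f. h \<notin> ?I}"
  let ?i = "\<lambda>((g, h), hs). hs @ [h]"
  let ?j = "\<lambda>gs. ((composite C (Dom C f) (butlast gs), last gs), butlast gs)"
  have fin: "finite (factor_pairs C f)" using finite_factor_pairs[OF f] .
  have "(\<Sum>gs \<in> factorisations C f - {[]}. (- 1) ^ length gs :: rat) =
      (\<Sum>((g, h), hs) \<in> Sigma ?N (\<lambda>(g, h). factorisations C g). - ((- 1) ^ length hs))"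
  proof (rule sum.reindex_bij_witness[where i = ?i and j = ?j])
    fix gs assume "gs \<in> factorisations C f - {[]}"
    moreover from this obtain hs h where "gs = hs @ [h]"
      by (cases gs rule: rev_cases) auto
    ultimately show "?i (?j gs) = gs"
      "?j gs \<in> Sigma ?N (\<lambda>(g, h). factorisations C g)"
      "(\<lambda>((g, h), hs). - ((- 1) ^ length hs)) (?j gs) = ((- 1) ^ length gs :: rat)"
      using composite_snoc[of "Dom C f" hs h]
      by (auto simp: factorisations_def factor_pairs_def composable_snoc composite_props)
  next
    fix p assume "p \<in> Sigma ?N (\<lambda>(g, h). factorisations C g)"
    then obtain g h hs where p: "p = ((g, h), hs)" "g \<in> Arr C" "h \<in> Arr C"
      "Cod C g = Dom C h" "Comp C h g = f" "h \<notin> ?I" "hs \<in> factorisations C g"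
      by (auto simp: factor_pairs_def)
    then have "Dom C f = Dom C g" using Comp_props by blast
    with p show "?j (?i p) = p" "?i p \<in> factorisations C f - {[]}"
      using composite_snoc[of "Dom C g" hs h]
      by (auto simp: factorisations_def composable_snoc)
  qed
  also have "\<dots> = (\<Sum>(g, h) \<in> ?N. - moebius C g)"
  proof -
    have "finite ?N" using fin by (rule finite_subset[rotated]) auto
    moreover have "finite (factorisations C g)" if "(g, h) \<in> ?N" for g h
      using that finite_factorisations by (auto simp: factor_pairs_def)
    ultimately show ?thesis
      by (subst sum.Sigma[symmetric])
         (auto simp: case_prod_unfold factor_pairs_def moebius_signed_sum sum_negf
           intro!: sum.cong)
  qed
  finally have "moebius C f = delta C f - (\<Sum>(g, h) \<in> ?N. moebius C g)"
    using moebius_split_Nil[OF f] by (simp add: case_prod_unfold sum_negf)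
  moreover have eq: "factor_pairs C f = insert (f, Ident C (Cod C f)) ?N"
    using f by (auto simp: factor_pairs_def Ident_props Cod_in_Obj Comp_Ident)
  then have "(\<Sum>(g, h) \<in> factor_pairs C f. moebius C g) =
      moebius C f + (\<Sum>(g, h) \<in> ?N. moebius C g)"
  proof -
    have "finite ?N" "(f, Ident C (Cod C f)) \<notin> ?N"
      using fin f by (auto simp: Cod_in_Obj intro: finite_subset[rotated])
    then show ?thesis by (subst eq, subst sum.insert) simp_all
  qed
  ultimately show ?thesis by simp
qed

text \<open>If an identity were a composite of two non-identities, these two could be prepended to any
of its factorisations without changing the parity of the length, so there would be no
longest even one.\<close>

lemma identity_indecomposable:
  assumes g: "g \<in> Hom C a b" and h: "h \<in> Hom C b a" and id: "Comp C h g = Ident C a"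
  shows "b = a" "g = Ident C a" "h = Ident C a"
proof -
  let ?I = "Ident C ` Obj C"
  let ?E = "even_factorisations C (Ident C a)"
  note gh = HomD[OF g] HomD[OF h]
  have "g \<in> ?I \<or> h \<in> ?I"
  proof (rule ccontr)
    assume nonid: "\<not> (g \<in> ?I \<or> h \<in> ?I)"
    have fin: "finite ?E" using finite_even gh Ident_props by auto
    have "[] \<in> ?E"
      using gh by (simp add: even_factorisations_def factorisations_def Ident_props)
    then have "?E \<noteq> {}" by auto
    then have "Max (length ` ?E) \<in> length ` ?E" using fin by simp
    then obtain gs where gs: "gs \<in> ?E" "length gs = Max (length ` ?E)" by auto
    have "Comp C (Comp C (composite C a gs) h) g = Ident C a"
      using gs(1) gh id Comp_Ident[of h]
      by (simp add: even_factorisations_def factorisations_def Ident_props)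
    then have "g # h # gs \<in> ?E"
      using gs(1) gh nonid
      by (auto simp: even_factorisations_def factorisations_def Ident_props)
    then have "length (g # h # gs) \<le> Max (length ` ?E)"
      using fin by (intro Max_ge finite_imageI imageI)
    with gs(2) show False by simp
  qed
  then show "b = a" "g = Ident C a" "h = Ident C a"
    using gh id Comp_Ident[of g] Comp_Ident[of h] by (auto simp: Ident_props)
qed

end

section \<open>Counting factorisations across an adjunction\<close>

locale moebius_adjunction =
  X: moebius_category X + Y: moebius_category Y + adjunction X Y Fo Fm Go Gm \<phi>
  for X :: "('o1, 'm1) category" and Y :: "('o2, 'm2) category"
    and Fo :: "'o1 \<Rightarrow> 'o2" and Fm :: "'m1 \<Rightarrow> 'm2"
    and Go :: "'o2 \<Rightarrow> 'o1" and Gm :: "'m2 \<Rightarrow> 'm1"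
    and \<phi> :: "'o1 \<Rightarrow> 'o2 \<Rightarrow> 'm2 \<Rightarrow> 'm1"
begin

lemma transpose_in_Hom:
  assumes "k \<in> Hom Y (Fo x) y" "x \<in> Obj X" "y \<in> Obj Y"
  shows "\<phi> x y k \<in> Hom X x (Go y)"
  using hom_bij[OF assms(2,3)] assms(1) by (auto simp: bij_betw_def)

lemma transpose_inj:
  assumes "k \<in> Hom Y (Fo x) y" "k' \<in> Hom Y (Fo x) y" "\<phi> x y k = \<phi> x y k'"
    "x \<in> Obj X" "y \<in> Obj Y"
  shows "k = k'"
  using hom_bij[OF assms(4,5)] assms(1-3) by (auto simp: bij_betw_def inj_on_def)

lemma transpose_surj:
  assumes "f \<in> Hom X x (Go y)" "x \<in> Obj X" "y \<in> Obj Y"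
  obtains k where "k \<in> Hom Y (Fo x) y" "\<phi> x y k = f"
proof -
  have "f \<in> \<phi> x y ` Hom Y (Fo x) y"
    using assms(1) bij_betw_imp_surj_on[OF hom_bij[OF assms(2,3)]] by simp
  then show thesis using that by (auto elim: imageE)
qed

text \<open>Naturality in one variable at a time: put an identity into the other one.\<close>

lemma transpose_precomp:
  assumes u: "u \<in> Hom X x' x" and k: "k \<in> Hom Y (Fo x) y"
  shows "\<phi> x' y (Comp Y k (Fm u)) = Comp X (\<phi> x y k) u"
proof -
  have x: "x \<in> Obj X" and y: "y \<in> Obj Y" using X.HomD[OF u] Y.HomD[OF k] by simp_all
  have "Comp X (\<phi> x y k) u \<in> Hom X x' (Go y)"
    using X.Comp_in_Hom[OF u transpose_in_Hom[OF k x y]] .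
  from X.Comp_Ident_left[OF this] show ?thesis
    using hom_natural[OF u k Y.Ident_in_Hom[OF y]]
    unfolding G.map_Ident[OF y] Y.Comp_Ident_left[OF Y.Comp_in_Hom[OF F.map_Hom[OF u] k]]
    by (rule trans[rotated])
qed

lemma transpose_postcomp:
  assumes k: "k \<in> Hom Y (Fo x) y" and v: "v \<in> Hom Y y y'" and x: "x \<in> Obj X"
  shows "\<phi> x y' (Comp Y v k) = Comp X (Gm v) (\<phi> x y k)"
  using hom_natural[OF X.Ident_in_Hom[OF x] k v]
  unfolding F.map_Ident[OF x] Y.Comp_Ident_right[OF k]
    X.Comp_Ident_right[OF transpose_in_Hom[OF k x Y.HomD(5)[OF k]]] .

text \<open>The factorisations of \<open>l\<close>, seen as an arrow from the object \<open>x\<close> of \<open>X\<close> to an object of \<open>Y\<close>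
(a heteromorphism), into an arrow \<open>f\<close> of \<open>X\<close> followed by a heteromorphism \<open>k\<close>.\<close>

definition mixed_pairs :: "'o1 \<Rightarrow> 'm2 \<Rightarrow> ('m1 \<times> 'm2) set" where
  "mixed_pairs x l = {(f, k). f \<in> Arr X \<and> Dom X f = x \<and>
     k \<in> Hom Y (Fo (Cod X f)) (Cod Y l) \<and> Comp Y k (Fm f) = l}"

text \<open>Transposing heteromorphisms turns these factorisations into ordinary factorisations in \<open>X\<close>,
so that local finiteness and Moebius inversion in \<open>X\<close> apply to them. Nothing similar has to
be done for \<open>Y\<close>: a heteromorphism is by encoding already an arrow of \<open>Y\<close>.\<close>

lemma mixed_pairs_bij:
  assumes l: "l \<in> Hom Y (Fo x) y" and x: "x \<in> Obj X"
  shows "bij_betw (\<lambda>(f, k). (f, \<phi> (Cod X f) y k))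
           (mixed_pairs x l) (factor_pairs X (\<phi> x y l))"
  unfolding bij_betw_def
proof
  note ol = Y.HomD[OF l]
  show "inj_on (\<lambda>(f, k). (f, \<phi> (Cod X f) y k)) (mixed_pairs x l)"
    using transpose_inj ol X.Cod_in_Obj by (auto simp: inj_on_def mixed_pairs_def)
  show "(\<lambda>(f, k). (f, \<phi> (Cod X f) y k)) ` mixed_pairs x l = factor_pairs X (\<phi> x y l)"
  proof (intro equalityI subsetI)
    fix p assume "p \<in> (\<lambda>(f, k). (f, \<phi> (Cod X f) y k)) ` mixed_pairs x l"
    then obtain f k where p: "p = (f, \<phi> (Cod X f) y k)" and f: "f \<in> Hom X x (Cod X f)"
      and k: "k \<in> Hom Y (Fo (Cod X f)) y" and kf: "Comp Y k (Fm f) = l"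
      using ol by (auto simp: mixed_pairs_def Hom_def)
    have "\<phi> (Cod X f) y k \<in> Hom X (Cod X f) (Go y)"
      using transpose_in_Hom[OF k] X.HomD[OF f] ol by simp
    then show "p \<in> factor_pairs X (\<phi> x y l)"
      using transpose_precomp[OF f k] p kf X.HomD[OF f]
      by (auto simp: factor_pairs_def Hom_def)
  next
    fix p assume "p \<in> factor_pairs X (\<phi> x y l)"
    then obtain f h where p: "p = (f, h)" "f \<in> Arr X" "h \<in> Arr X" "Cod X f = Dom X h"
      and hf: "Comp X h f = \<phi> x y l"
      by (auto simp: factor_pairs_def)
    note t = X.HomD[OF transpose_in_Hom[OF l x ol(5)]]
    have "Dom X f = x" "Cod X h = Go y"
      using X.Comp_props[OF p(2-4)] t hf by auto
    then have f: "f \<in> Hom X x (Cod X f)" and h: "h \<in> Hom X (Cod X f) (Go y)"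
      using p by (auto simp: Hom_def)
    from transpose_surj[OF h] X.HomD[OF f] ol
    obtain k where k: "k \<in> Hom Y (Fo (Cod X f)) y" "\<phi> (Cod X f) y k = h" by metis
    have "\<phi> x y (Comp Y k (Fm f)) = \<phi> x y l"
      using transpose_precomp[OF f k(1)] k(2) hf by simp
    moreover have "Comp Y k (Fm f) \<in> Hom Y (Fo x) y"
      using Y.Comp_in_Hom[OF F.map_Hom[OF f] k(1)] .
    ultimately have "Comp Y k (Fm f) = l"
      using transpose_inj l x ol by blast
    then have "(f, k) \<in> mixed_pairs x l"
      using f k ol by (auto simp: mixed_pairs_def Hom_def)
    then show "p \<in> (\<lambda>(f, k). (f, \<phi> (Cod X f) y k)) ` mixed_pairs x l"
      using p k by (auto intro: rev_image_eqI)
  qed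
qed

lemma transpose_in_Arr:
  assumes "l \<in> Hom Y (Fo x) y" "x \<in> Obj X"
  shows "\<phi> x y l \<in> Arr X"
  using transpose_in_Hom[OF assms Y.HomD(5)[OF assms(1)]] by (rule X.HomD(1))

lemma finite_mixed_pairs:
  assumes "l \<in> Hom Y (Fo x) y" "x \<in> Obj X"
  shows "finite (mixed_pairs x l)"
  using bij_betw_finite[OF mixed_pairs_bij[OF assms]]
    X.finite_factor_pairs[OF transpose_in_Arr[OF assms]] by simp

lemma sum_mixed_pairs:
  assumes "l \<in> Hom Y (Fo x) y" "x \<in> Obj X"
  shows "(\<Sum>(f, k) \<in> mixed_pairs x l. moebius X f) = delta X (\<phi> x y l)"
proof -
  have "(\<Sum>(f, k) \<in> mixed_pairs x l. moebius X f) =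
      (\<Sum>(f, h) \<in> factor_pairs X (\<phi> x y l). moebius X f)"
    using sum.reindex_bij_betw[OF mixed_pairs_bij[OF assms], of "\<lambda>(f, h). moebius X f"]
    by (simp add: case_prod_unfold)
  also have "\<dots> = delta X (\<phi> x y l)"
    using transpose_in_Arr[OF assms] by (rule X.moebius_zeta)
  finally show ?thesis .
qed

definition left_fibre :: "'o1 \<Rightarrow> 'o2 \<Rightarrow> 'm2 \<Rightarrow> ('o1 \<times> 'm1) set" where
  "left_fibre x y m = {(x', f) \<in> left_index X Fo x y. Fm f = m}"

text \<open>If \<open>\<epsilon> : F x \<rightarrow> y'\<close> denotes the transpose of the identity of \<open>x = G y'\<close>, then \<open>G g\<close> is the
transpose of \<open>g \<circ> \<epsilon>\<close>. The fibre thus consists of the \<open>g\<close> with \<open>g \<circ> \<epsilon> = m\<close>.\<close>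

definition right_fibre :: "'o1 \<Rightarrow> 'o2 \<Rightarrow> 'm2 \<Rightarrow> ('o2 \<times> 'm2) set" where
  "right_fibre x y m = {(y', g) \<in> right_index Y Go x y. Gm g = \<phi> x y m}"

text \<open>The terms on which \<open>\<mu>\<^sub>X * \<zeta> * \<mu>\<^sub>Y\<close> is supported once \<open>\<zeta> * \<mu>\<^sub>Y\<close> has collapsed to \<open>\<delta>\<close>: if the
second factor \<open>k : F x' \<rightarrow> y\<close> of \<open>m\<close> is an identity then \<open>F x' = y\<close> and \<open>m = F f\<close>.\<close>

lemma left_fibre_bij:
  assumes m: "m \<in> Hom Y (Fo x) y"
  shows "bij_betw (\<lambda>(f, k). (Cod X f, f))
           {(f, k) \<in> mixed_pairs x m. k \<in> Ident Y ` Obj Y} (left_fibre x y m)"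
proof (rule bij_betw_byWitness[where f' = "\<lambda>(x', f). (f, Ident Y y)"])
  note om = Y.HomD[OF m]
  have 1: "k = Ident Y y \<and> Fo (Cod X f) = y \<and> Fm f = m \<and> f \<in> Hom X x (Cod X f)"
    if "(f, k) \<in> mixed_pairs x m" "k \<in> Ident Y ` Obj Y" for f k
  proof -
    from that have f: "f \<in> Hom X x (Cod X f)"
      and k: "k \<in> Hom Y (Fo (Cod X f)) y" "Comp Y k (Fm f) = m"
      using om by (auto simp: mixed_pairs_def Hom_def)
    from that(2) obtain b where "b \<in> Obj Y" "k = Ident Y b" by auto
    with Y.HomD[OF k(1)] have "k = Ident Y y" "Fo (Cod X f) = y"
      by (auto simp: Y.Ident_props)
    moreover from this have "Fm f = m"
      using k F.map_Hom[OF f] Y.Comp_Ident_left by auto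
    ultimately show ?thesis using f by simp
  qed
  have 2: "x' = Cod X f \<and> (f, Ident Y y) \<in> mixed_pairs x m \<and> Ident Y y \<in> Ident Y ` Obj Y"
    if "(x', f) \<in> left_fibre x y m" for x' f
  proof -
    from that have f: "f \<in> Hom X x x'" "Fo x' = y" "Fm f = m"
      by (auto simp: left_fibre_def left_index_def)
    with F.map_Hom[OF f(1)] om show ?thesis
      using Y.Comp_Ident_left[of m "Fo x" y] m Y.Ident_in_Hom[of y]
      by (auto simp: mixed_pairs_def Hom_def)
  qed
  show "\<forall>p \<in> {(f, k) \<in> mixed_pairs x m. k \<in> Ident Y ` Obj Y}.
      (\<lambda>(x', f). (f, Ident Y y)) ((\<lambda>(f, k). (Cod X f, f)) p) = p"
    using 1 by fastforce
  show "\<forall>p \<in> left_fibre x y m. (\<lambda>(f, k). (Cod X f, f)) ((\<lambda>(x', f). (f, Ident Y y)) p) = p"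
    using 2 by fastforce
  show "(\<lambda>(f, k). (Cod X f, f)) ` {(f, k) \<in> mixed_pairs x m. k \<in> Ident Y ` Obj Y}
      \<subseteq> left_fibre x y m"
    using 1 X.HomD(5) by (fastforce simp: left_fibre_def left_index_def)
  show "(\<lambda>(x', f). (f, Ident Y y)) ` left_fibre x y m
      \<subseteq> {(f, k) \<in> mixed_pairs x m. k \<in> Ident Y ` Obj Y}"
    using 2 by fastforce
qed

text \<open>The corresponding collapse of \<open>\<mu>\<^sub>X * \<zeta>\<close>: if the first factor \<open>l : F x \<rightarrow> y'\<close> of \<open>m\<close> has an
identity as its transpose, then \<open>x = G y'\<close> and naturality gives \<open>G g = \<phi> m\<close>. Conversely
\<open>l\<close> is determined by \<open>y'\<close>, being the inverse transpose of the identity of \<open>x\<close>.\<close>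

lemma right_fibre_bij:
  assumes m: "m \<in> Hom Y (Fo x) y" and x: "x \<in> Obj X"
  shows "bij_betw (\<lambda>(l, g). (Dom Y g, g))
           {(l, g) \<in> factor_pairs Y m. \<phi> x (Cod Y l) l \<in> Ident X ` Obj X} (right_fibre x y m)"
  unfolding bij_betw_def
proof
  note om = Y.HomD[OF m]
  let ?S = "{(l, g) \<in> factor_pairs Y m. \<phi> x (Cod Y l) l \<in> Ident X ` Obj X}"
  have 1: "l \<in> Hom Y (Fo x) (Dom Y g) \<and> g \<in> Hom Y (Dom Y g) y \<and> Go (Dom Y g) = x \<and>
      \<phi> x (Dom Y g) l = Ident X x \<and> Gm g = \<phi> x y m"
    if "(l, g) \<in> ?S" for l g
  proof -
    from that have lg: "l \<in> Arr Y" "g \<in> Arr Y" "Cod Y l = Dom Y g" "Comp Y g l = m"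
      by (auto simp: factor_pairs_def)
    then have l: "l \<in> Hom Y (Fo x) (Dom Y g)" and g: "g \<in> Hom Y (Dom Y g) y"
      using Y.Comp_props[OF lg(1-3)] om by (auto simp: Hom_def)
    have t: "\<phi> x (Dom Y g) l \<in> Hom X x (Go (Dom Y g))"
      using transpose_in_Hom[OF l x] Y.HomD[OF g] by simp
    from that lg obtain a where "a \<in> Obj X" "\<phi> x (Dom Y g) l = Ident X a" by auto
    with X.HomD[OF t] have *: "\<phi> x (Dom Y g) l = Ident X x" "Go (Dom Y g) = x"
      by (auto simp: X.Ident_props)
    moreover have "Gm g = \<phi> x y m"
      using transpose_postcomp[OF l g x] lg(4) * X.Comp_Ident_right[of "Gm g" x] G.map_Hom[OF g]
      by auto
    ultimately show ?thesis using l g by simp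
  qed
  show "inj_on (\<lambda>(l, g). (Dom Y g, g)) ?S"
  proof (rule inj_onI)
    fix p q assume pq: "p \<in> ?S" "q \<in> ?S"
      and eq: "(\<lambda>(l, g). (Dom Y g, g)) p = (\<lambda>(l, g). (Dom Y g, g)) q"
    obtain l g l' where p: "p = (l, g)" and q: "q = (l', g)"
      using eq by (cases p, cases q) auto
    from 1[OF pq(1)[unfolded p]] 1[OF pq(2)[unfolded q]] have "l = l'"
      using transpose_inj[of l x "Dom Y g" l'] x Y.HomD(4)[of g "Dom Y g" y] by metis
    with p q show "p = q" by simp
  qed
  show "(\<lambda>(l, g). (Dom Y g, g)) ` ?S = right_fibre x y m"
  proof (intro equalityI subsetI)
    fix p assume "p \<in> (\<lambda>(l, g). (Dom Y g, g)) ` ?S"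
    then obtain l g where p: "p = (Dom Y g, g)" and lg: "(l, g) \<in> ?S" by auto
    from 1[OF lg] Y.HomD(4)[of g "Dom Y g" y] show "p \<in> right_fibre x y m"
      by (simp add: p right_fibre_def right_index_def)
  next
    fix p assume "p \<in> right_fibre x y m"
    then obtain y' g where p: "p = (y', g)" and g: "g \<in> Hom Y y' y" "Go y' = x" "Gm g = \<phi> x y m"
      by (auto simp: right_fibre_def right_index_def)
    note og = Y.HomD[OF g(1)]
    have "Ident X x \<in> Hom X x (Go y')" using X.Ident_in_Hom[OF x] g by simp
    from transpose_surj[OF this x og(4)]
    obtain l where l: "l \<in> Hom Y (Fo x) y'" "\<phi> x y' l = Ident X x" .
    have "\<phi> x y (Comp Y g l) = \<phi> x y m"
      using transpose_postcomp[OF l(1) g(1) x] l(2) g X.Comp_Ident_right[of "Gm g" x]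
        G.map_Hom[OF g(1)] by auto
    with Y.Comp_in_Hom[OF l(1) g(1)] have "Comp Y g l = m"
      using transpose_inj m x om(5) by blast
    then have "(l, g) \<in> ?S"
      using l g x og Y.HomD[OF l(1)] by (auto simp: factor_pairs_def)
    then show "p \<in> (\<lambda>(l, g). (Dom Y g, g)) ` ?S"
      using p og by (auto intro: rev_image_eqI)
  qed
qed

lemma finite_left_fibre:
  assumes "m \<in> Hom Y (Fo x) y" "x \<in> Obj X"
  shows "finite (left_fibre x y m)"
proof -
  have "finite {(f, k) \<in> mixed_pairs x m. k \<in> Ident Y ` Obj Y}"
    using finite_mixed_pairs[OF assms] by (rule finite_subset[rotated]) auto
  then show ?thesis using bij_betw_finite[OF left_fibre_bij[OF assms(1)]] by simp
qed

lemma finite_right_fibre: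
  assumes "m \<in> Hom Y (Fo x) y" "x \<in> Obj X"
  shows "finite (right_fibre x y m)"
proof -
  have "finite {(l, g) \<in> factor_pairs Y m. \<phi> x (Cod Y l) l \<in> Ident X ` Obj X}"
    using Y.finite_factor_pairs[OF Y.HomD(1)[OF assms(1)]]
    by (rule finite_subset[rotated]) auto
  then show ?thesis using bij_betw_finite[OF right_fibre_bij[OF assms]] by simp
qed

text \<open>Both sides are the value at \<open>m\<close> of \<open>\<mu>\<^sub>X * \<zeta> * \<mu>\<^sub>Y\<close>, where \<open>\<zeta>\<close> is constantly \<open>1\<close> on
heteromorphisms: the sum of \<open>\<mu>(f) \<mu>(g)\<close> over all \<open>m = g \<circ> k \<circ> F f\<close>. The two ways of
bracketing such a composite correspond to the two orders of summation.\<close>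

lemma fibre_sums_eq:
  assumes m: "m \<in> Hom Y (Fo x) y" and x: "x \<in> Obj X"
  shows "(\<Sum>(x', f) \<in> left_fibre x y m. moebius X f) =
         (\<Sum>(y', g) \<in> right_fibre x y m. moebius Y g)"
proof -
  note om = Y.HomD[OF m]
  let ?L = "mixed_pairs x m" and ?R = "factor_pairs Y m"
  have finL: "finite ?L" using finite_mixed_pairs[OF m x] .
  have finR: "finite ?R" using Y.finite_factor_pairs om by simp
  have Lk: "k \<in> Arr Y \<and> Cod Y k = y" if "(f, k) \<in> ?L" for f k
    using that om by (auto simp: mixed_pairs_def Hom_def)
  have Rl: "l \<in> Hom Y (Fo x) (Cod Y l)" if "(l, g) \<in> ?R" for l g
    using that om Y.Comp_props[of l g] by (auto simp: factor_pairs_def Hom_def)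
  have finM: "finite (mixed_pairs x l)" if "(l, g) \<in> ?R" for l g
    using finite_mixed_pairs[OF Rl[OF that] x] .
  have "(\<Sum>(x', f) \<in> left_fibre x y m. moebius X f) =
      (\<Sum>(f, k) \<in> {(f, k) \<in> ?L. k \<in> Ident Y ` Obj Y}. moebius X f)"
    using sum.reindex_bij_betw[OF left_fibre_bij[OF m], of "\<lambda>(x', f). moebius X f"]
    by (simp add: case_prod_unfold)
  also have "\<dots> = (\<Sum>(f, k) \<in> ?L. moebius X f * delta Y k)"
    using finL by (intro sum.mono_neutral_cong_left) (auto simp: delta_def)
  also have "\<dots> = (\<Sum>(f, n) \<in> ?L. moebius X f * (\<Sum>(k, g) \<in> factor_pairs Y n. moebius Y g))"
    using Lk Y.zeta_moebius by (intro sum.cong) auto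
  also have "\<dots> = (\<Sum>((f, n), (k, g)) \<in> Sigma ?L (\<lambda>(f, n). factor_pairs Y n).
      moebius X f * moebius Y g)"
    using finL Lk Y.finite_factor_pairs
    by (subst sum.Sigma[symmetric]) (auto simp: sum_distrib_left case_prod_unfold)
  also have "\<dots> = (\<Sum>((l, g), (f, k)) \<in> Sigma ?R (\<lambda>(l, g). mixed_pairs x l).
      moebius X f * moebius Y g)"
  proof (rule sum.reindex_bij_witness
      [where i = "\<lambda>((l, g), (f, k)). ((f, Comp Y g k), (k, g))"
         and j = "\<lambda>((f, n), (k, g)). ((Comp Y k (Fm f), g), (f, k))"])
    fix p assume "p \<in> Sigma ?L (\<lambda>(f, n). factor_pairs Y n)"
    then obtain f n k g where p: "p = ((f, n), (k, g))"
      and fn: "f \<in> Arr X" "Dom X f = x" "n \<in> Hom Y (Fo (Cod X f)) y" "Comp Y n (Fm f) = m"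
      and kg: "k \<in> Arr Y" "g \<in> Arr Y" "Cod Y k = Dom Y g" "Comp Y g k = n"
      using om by (auto simp: mixed_pairs_def factor_pairs_def)
    have f: "Fm f \<in> Hom Y (Fo x) (Fo (Cod X f))"
      using fn F.map_Hom[of f x "Cod X f"] by (simp add: Hom_def)
    have k: "k \<in> Hom Y (Fo (Cod X f)) (Dom Y g)" and g: "g \<in> Hom Y (Dom Y g) y"
      using fn kg Y.Comp_props[OF kg(1-3)] by (auto simp: Hom_def)
    have "Comp Y g (Comp Y k (Fm f)) = m"
      using Y.Comp_assoc[OF f k g] kg fn by simp
    then show "(\<lambda>((l, g), (f, k)). ((f, Comp Y g k), (k, g)))
        ((\<lambda>((f, n), (k, g)). ((Comp Y k (Fm f), g), (f, k))) p) = p"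
      "(\<lambda>((f, n), (k, g)). ((Comp Y k (Fm f), g), (f, k))) p
        \<in> Sigma ?R (\<lambda>(l, g). mixed_pairs x l)"
      "(\<lambda>((l, g), (f, k)). moebius X f * moebius Y g)
        ((\<lambda>((f, n), (k, g)). ((Comp Y k (Fm f), g), (f, k))) p) =
        (\<lambda>((f, n), (k, g)). moebius X f * moebius Y g) p"
      using p fn kg k g Y.HomD[OF Y.Comp_in_Hom[OF f k]]
      by (auto simp: mixed_pairs_def factor_pairs_def)
  next
    fix p assume p': "p \<in> Sigma ?R (\<lambda>(l, g). mixed_pairs x l)"
    then obtain l g f k where p: "p = ((l, g), (f, k))"
      and lg: "l \<in> Arr Y" "g \<in> Arr Y" "Cod Y l = Dom Y g" "Comp Y g l = m"
      and fk: "f \<in> Arr X" "Dom X f = x" "k \<in> Hom Y (Fo (Cod X f)) (Dom Y g)"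
        "Comp Y k (Fm f) = l"
      by (auto simp: mixed_pairs_def factor_pairs_def)
    have f: "Fm f \<in> Hom Y (Fo x) (Fo (Cod X f))"
      using fk F.map_Hom[of f x "Cod X f"] by (simp add: Hom_def)
    have g: "g \<in> Hom Y (Dom Y g) y"
      using lg om Y.Comp_props[OF lg(1-3)] by (auto simp: Hom_def)
    have "Comp Y (Comp Y g k) (Fm f) = m"
      using Y.Comp_assoc[OF f fk(3) g] lg fk by simp
    then show "(\<lambda>((f, n), (k, g)). ((Comp Y k (Fm f), g), (f, k)))
        ((\<lambda>((l, g), (f, k)). ((f, Comp Y g k), (k, g))) p) = p"
      "(\<lambda>((l, g), (f, k)). ((f, Comp Y g k), (k, g))) p
        \<in> Sigma ?L (\<lambda>(f, n). factor_pairs Y n)"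
      using p lg fk om Y.Comp_in_Hom[OF fk(3) g] Y.HomD[OF fk(3)]
      by (auto simp: mixed_pairs_def factor_pairs_def)
  qed
  also have "\<dots> = (\<Sum>(l, g) \<in> ?R. (\<Sum>(f, k) \<in> mixed_pairs x l. moebius X f) * moebius Y g)"
    using finR finM
    by (subst sum.Sigma[symmetric]) (auto simp: sum_distrib_right case_prod_unfold)
  also have "\<dots> = (\<Sum>(l, g) \<in> ?R. delta X (\<phi> x (Cod Y l) l) * moebius Y g)"
    using Rl sum_mixed_pairs[OF _ x] by (intro sum.cong) auto
  also have "\<dots> = (\<Sum>(l, g) \<in> {(l, g) \<in> ?R. \<phi> x (Cod Y l) l \<in> Ident X ` Obj X}. moebius Y g)"
    using finR by (intro sum.mono_neutral_cong_right) (auto simp: delta_def)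
  also have "\<dots> = (\<Sum>(y', g) \<in> right_fibre x y m. moebius Y g)"
    using sum.reindex_bij_betw[OF right_fibre_bij[OF m x], of "\<lambda>(y', g). moebius Y g"]
    by (simp add: case_prod_unfold)
  finally show ?thesis .
qed

end

section \<open>Summing over the fibres\<close>

text \<open>The set \<open>M\<close> of labels has to cover only the support of \<open>\<mu>\<close>, while the fibres \<open>B m\<close> are taken
in the whole, possibly infinite, index set.\<close>

lemma sum_over_fibres:
  fixes \<mu> :: "'a \<Rightarrow> 'b::comm_monoid_add"
  assumes "finite S" "finite M" "lab ` S \<subseteq> M" and S: "S = {p \<in> I. \<mu> p \<noteq> 0}"
    and B: "\<And>m. m \<in> M \<Longrightarrow> finite (B m)" "\<And>m. m \<in> M \<Longrightarrow> B m = {p \<in> I. lab p = m}"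
  shows "sum \<mu> S = (\<Sum>m \<in> M. sum \<mu> (B m))"
proof -
  have "sum \<mu> S = (\<Sum>m \<in> M. sum \<mu> {p \<in> S. lab p = m})"
    using assms(1-3) by (simp add: sum.group)
  also have "\<dots> = (\<Sum>m \<in> M. sum \<mu> (B m))"
  proof (rule sum.cong[OF refl])
    fix m assume m: "m \<in> M"
    show "sum \<mu> {p \<in> S. lab p = m} = sum \<mu> (B m)"
      using B[OF m] S by (intro sum.mono_neutral_left) auto
  qed
  finally show ?thesis .
qed

lemma sum_moebius_support:
  "finite I \<Longrightarrow> (\<Sum>(a, f) \<in> moebius_support C I. moebius C f) = (\<Sum>(a, f) \<in> I. moebius C f)"
  by (rule sum.mono_neutral_left) (auto simp: moebius_support_def)

context moebius_adjunction
begin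

lemma support_sums_eq:
  assumes x: "x \<in> Obj X" and y: "y \<in> Obj Y"
    and finL: "finite (moebius_support X (left_index X Fo x y))"
    and finR: "finite (moebius_support Y (right_index Y Go x y))"
  shows "(\<Sum>(x', f) \<in> moebius_support X (left_index X Fo x y). moebius X f) =
         (\<Sum>(y', g) \<in> moebius_support Y (right_index Y Go x y). moebius Y g)"
proof -
  let ?L = "moebius_support X (left_index X Fo x y)"
  let ?R = "moebius_support Y (right_index Y Go x y)"
  let ?H = "Hom Y (Fo x) y"
  define labL :: "'o1 \<times> 'm1 \<Rightarrow> 'm2" where "labL = (\<lambda>(x', f). Fm f)"
  \<comment> \<open>\<open>labR\<close> sends \<open>g\<close> to the unique \<open>m\<close> with \<open>\<phi> m = G g\<close>, so that both index sets are
    fibred over the same hom-set.\<close>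
  define labR :: "'o2 \<times> 'm2 \<Rightarrow> 'm2" where "labR = (\<lambda>(y', g). inv_into ?H (\<phi> x y) (Gm g))"
  note bij = hom_bij[OF x y]
  have labL: "labL p \<in> ?H" if "p \<in> left_index X Fo x y" for p
    using that F.map_Hom by (auto simp: labL_def left_index_def)
  have Gg: "Gm g \<in> \<phi> x y ` ?H" if "(y', g) \<in> right_index Y Go x y" for y' g
    using that G.map_Hom bij by (auto simp: right_index_def bij_betw_def)
  have labR: "labR p \<in> ?H" if "p \<in> right_index Y Go x y" for p
    using that by (cases p) (simp add: labR_def inv_into_into[OF Gg])
  have labR_iff: "labR (y', g) = m \<longleftrightarrow> Gm g = \<phi> x y m"
    if "(y', g) \<in> right_index Y Go x y" "m \<in> ?H" for y' g m
    using f_inv_into_f[OF Gg[OF that(1)]] inv_into_f_f[OF bij_betw_imp_inj_on[OF bij] that(2)]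
    by (auto simp: labR_def)
  define M where "M = labL ` ?L \<union> labR ` ?R"
  have M: "finite M" "labL ` ?L \<subseteq> M" "labR ` ?R \<subseteq> M"
    using finL finR by (auto simp: M_def)
  have MH: "M \<subseteq> ?H"
    using labL labR by (auto simp: M_def moebius_support_def)
  have "(\<Sum>(x', f) \<in> ?L. moebius X f) =
      (\<Sum>m \<in> M. \<Sum>(x', f) \<in> left_fibre x y m. moebius X f)"
    using finL M(1,2)
  proof (rule sum_over_fibres)
    show "?L = {p \<in> left_index X Fo x y. (case p of (x', f) \<Rightarrow> moebius X f) \<noteq> 0}"
      by (auto simp: moebius_support_def)
    show "finite (left_fibre x y m)" if "m \<in> M" for m
      using that MH finite_left_fibre x by auto
    show "left_fibre x y m = {p \<in> left_index X Fo x y. labL p = m}" for m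
      by (auto simp: left_fibre_def labL_def)
  qed
  also have "\<dots> = (\<Sum>m \<in> M. \<Sum>(y', g) \<in> right_fibre x y m. moebius Y g)"
    using MH fibre_sums_eq x by (intro sum.cong) auto
  also have "\<dots> = (\<Sum>(y', g) \<in> ?R. moebius Y g)"
    using finR M(1,3)
  proof (rule sum_over_fibres[symmetric])
    show "?R = {p \<in> right_index Y Go x y. (case p of (y', g) \<Rightarrow> moebius Y g) \<noteq> 0}"
      by (auto simp: moebius_support_def)
    show "finite (right_fibre x y m)" if "m \<in> M" for m
      using that MH finite_right_fibre x by auto
    show "right_fibre x y m = {p \<in> right_index Y Go x y. labR p = m}" if "m \<in> M" for m
      using that MH labR_iff by (auto simp: right_fibre_def)
  qed
  finally show ?thesis .
qed

section \<open>Finiteness of the index sets\<close>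

lemma finite_left_index:
  assumes "x \<in> Obj X" "finite (Hom Y (Fo x) y)"
  shows "finite (left_index X Fo x y)"
proof (rule finite_subset)
  show "left_index X Fo x y \<subseteq> (\<Union>m \<in> Hom Y (Fo x) y. left_fibre x y m)"
    using F.map_Hom by (auto simp: left_fibre_def left_index_def)
  show "finite (\<Union>m \<in> Hom Y (Fo x) y. left_fibre x y m)"
    using assms finite_left_fibre by auto
qed

lemma finite_right_index:
  assumes "x \<in> Obj X" "y \<in> Obj Y" "finite (Hom Y (Fo x) y)"
  shows "finite (right_index Y Go x y)"
proof (rule finite_subset)
  show "right_index Y Go x y \<subseteq> (\<Union>m \<in> Hom Y (Fo x) y. right_fibre x y m)"
  proof clarify
    fix y' g assume i: "(y', g) \<in> right_index Y Go x y"
    then have "Gm g \<in> Hom X x (Go y)"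
      using G.map_Hom by (auto simp: right_index_def)
    from transpose_surj[OF this assms(1,2)] obtain m
      where "m \<in> Hom Y (Fo x) y" "\<phi> x y m = Gm g" .
    with i have "(y', g) \<in> right_fibre x y m" by (simp add: right_fibre_def)
    with \<open>m \<in> _\<close> show "(y', g) \<in> (\<Union>m \<in> Hom Y (Fo x) y. right_fibre x y m)" by blast
  qed
  show "finite (\<Union>m \<in> Hom Y (Fo x) y. right_fibre x y m)"
    using assms finite_right_fibre by auto
qed

text \<open>A triangle identity exhibits the identity of \<open>G y'\<close> as the unit at \<open>G y'\<close> followed by \<open>G \<epsilon>\<close>.
Identities being indecomposable, the unit is an identity, so its source and target agree.\<close>

lemma GF_fixes_image:
  assumes y': "y' \<in> Obj Y"
  shows "Go (Fo (Go y')) = Go y'"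
proof -
  let ?x = "Go y'"
  have x: "?x \<in> Obj X" using G.map_Obj[OF y'] .
  from transpose_surj[OF X.Ident_in_Hom[OF x] x y']
  obtain e where e: "e \<in> Hom Y (Fo ?x) y'" "\<phi> ?x y' e = Ident X ?x" .
  have i: "Ident Y (Fo ?x) \<in> Hom Y (Fo ?x) (Fo ?x)"
    using Y.Ident_in_Hom F.map_Obj x by blast
  have u: "\<phi> ?x (Fo ?x) (Ident Y (Fo ?x)) \<in> Hom X ?x (Go (Fo ?x))"
    using transpose_in_Hom[OF i x F.map_Obj[OF x]] .
  have "Comp X (Gm e) (\<phi> ?x (Fo ?x) (Ident Y (Fo ?x))) = Ident X ?x"
    using transpose_postcomp[OF i e(1) x] Y.Comp_Ident_right[OF e(1)] e(2) by simp
  from X.identity_indecomposable(1)[OF u G.map_Hom[OF e(1)] this] show ?thesis .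
qed

text \<open>The same argument with the other triangle identity: the identity of \<open>F x'\<close> is \<open>F\<close> of the unit
\<open>u\<close> followed by the counit \<open>e\<close>.\<close>

lemma FG_fixes_image:
  assumes x': "x' \<in> Obj X"
  shows "Fo (Go (Fo x')) = Fo x'"
proof -
  let ?y = "Fo x'"
  have y: "?y \<in> Obj Y" using F.map_Obj[OF x'] .
  have Gy: "Go ?y \<in> Obj X" using G.map_Obj[OF y] .
  from transpose_surj[OF X.Ident_in_Hom[OF Gy] Gy y]
  obtain e where e: "e \<in> Hom Y (Fo (Go ?y)) ?y" "\<phi> (Go ?y) ?y e = Ident X (Go ?y)" .
  have i: "Ident Y ?y \<in> Hom Y ?y ?y" using Y.Ident_in_Hom[OF y] .
  define u where "u = \<phi> x' ?y (Ident Y ?y)"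
  have u: "u \<in> Hom X x' (Go ?y)"
    unfolding u_def using transpose_in_Hom[OF i x' y] .
  have "\<phi> x' ?y (Comp Y e (Fm u)) = \<phi> x' ?y (Ident Y ?y)"
    using transpose_precomp[OF u e(1)] e(2) X.Comp_Ident_left[OF u] by (simp add: u_def)
  then have "Comp Y e (Fm u) = Ident Y ?y"
    by (rule transpose_inj[OF Y.Comp_in_Hom[OF F.map_Hom[OF u] e(1)] i _ x' y])
  from Y.identity_indecomposable(1)[OF F.map_Hom[OF u] e(1) this] show ?thesis .
qed

text \<open>Fibres being finite, finiteness of the hom-set bounds the index set. For the converse, a
nonempty index set gives \<open>F (G y) = y\<close>, and then every arrow \<open>x \<rightarrow> G y\<close> is itself one of the
indices.\<close>

lemma finite_left_index_iff:
  assumes x: "x \<in> Obj X" and y: "y \<in> Obj Y" and ne: "left_index X Fo x y \<noteq> {}"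
  shows "finite (left_index X Fo x y) \<longleftrightarrow> finite (Hom Y (Fo x) y)"
proof
  assume fin: "finite (left_index X Fo x y)"
  have "Fo (Go y) = y"
    using ne FG_fixes_image by (auto simp: left_index_def)
  then have "Pair (Go y) ` Hom X x (Go y) \<subseteq> left_index X Fo x y"
    using G.map_Obj[OF y] by (auto simp: left_index_def)
  from finite_subset[OF this fin] have "finite (Hom X x (Go y))"
    by (rule finite_imageD) (simp add: inj_on_def)
  then show "finite (Hom Y (Fo x) y)" using bij_betw_finite[OF hom_bij[OF x y]] by simp
qed (rule finite_left_index[OF x])

lemma finite_right_index_iff:
  assumes x: "x \<in> Obj X" and y: "y \<in> Obj Y" and ne: "right_index Y Go x y \<noteq> {}"
  shows "finite (right_index Y Go x y) \<longleftrightarrow> finite (Hom Y (Fo x) y)"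
proof
  assume fin: "finite (right_index Y Go x y)"
  have "Go (Fo x) = x"
    using ne GF_fixes_image by (auto simp: right_index_def)
  then have "Pair (Fo x) ` Hom Y (Fo x) y \<subseteq> right_index Y Go x y"
    using F.map_Obj[OF x] by (auto simp: right_index_def)
  from finite_subset[OF this fin] show "finite (Hom Y (Fo x) y)"
    by (rule finite_imageD) (simp add: inj_on_def)
qed (rule finite_right_index[OF x y])

text \<open>A sum over an infinite set has the value \<open>0\<close> by convention, so infinite index sets need
attention. If neither index set is empty, both are finite exactly when the hom-set
\<open>F x \<rightarrow> y\<close> is; hence if one of them is infinite, the other is infinite or empty.\<close>

lemma index_sums_eq:
  assumes x: "x \<in> Obj X" and y: "y \<in> Obj Y"
  shows "(\<Sum>(x', f) \<in> left_index X Fo x y. moebius X f) =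
         (\<Sum>(y', g) \<in> right_index Y Go x y. moebius Y g)"
proof (cases "finite (left_index X Fo x y) \<and> finite (right_index Y Go x y)")
  case True
  then have "finite (moebius_support X (left_index X Fo x y))"
    "finite (moebius_support Y (right_index Y Go x y))"
    by (auto simp: moebius_support_def elim: finite_subset[rotated])
  from support_sums_eq[OF x y this] True show ?thesis
    by (simp add: sum_moebius_support)
next
  case False
  have "infinite (left_index X Fo x y) \<or> left_index X Fo x y = {}"
    using False finite_left_index_iff[OF x y] finite_right_index[OF x y] by auto
  moreover have "infinite (right_index Y Go x y) \<or> right_index Y Go x y = {}"
    using False finite_right_index_iff[OF x y] finite_left_index[OF x] by auto
  ultimately show ?thesis by auto
qed

end

theorem mainTheorem1:
  fixes X :: "('o1, 'm1) category" and Y :: "('o2, 'm2) category"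
    and Fo :: "'o1 \<Rightarrow> 'o2" and Fm :: "'m1 \<Rightarrow> 'm2"
    and Go :: "'o2 \<Rightarrow> 'o1" and Gm :: "'m2 \<Rightarrow> 'm1"
    and \<phi> :: "'o1 \<Rightarrow> 'o2 \<Rightarrow> 'm2 \<Rightarrow> 'm1"
    and x :: 'o1 and y :: 'o2
  assumes "moebius_category X" and "moebius_category Y"
    and "adjunction X Y Fo Fm Go Gm \<phi>"
    and "x \<in> Obj X" and "y \<in> Obj Y"
  shows "(\<Sum>(x', f) \<in> left_index X Fo x y. moebius X f)
           = (\<Sum>(y', g) \<in> right_index Y Go x y. moebius Y g) \<and>
         (finite (moebius_support X (left_index X Fo x y)) \<longrightarrow>
          finite (moebius_support Y (right_index Y Go x y)) \<longrightarrow>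
          (\<Sum>(x', f) \<in> moebius_support X (left_index X Fo x y). moebius X f)
           = (\<Sum>(y', g) \<in> moebius_support Y (right_index Y Go x y). moebius Y g))"
proof -
  interpret moebius_adjunction X Y Fo Fm Go Gm \<phi>
    using assms(1-3) by (rule moebius_adjunction.intro)
  show ?thesis
    using index_sums_eq[OF assms(4,5)] support_sums_eq[OF assms(4,5)] by (intro conjI impI)
qed

end
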